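(* Let $M$ be a Riemannian manifold, let $\eta:M\times M\to TM$ satisfy $\eta(u,v)\in T_vM$ for all $u,v\in M$, and let $m$ be a positive integer. Let $S\subseteq M$ be an open geodesic invex set with respect to $\eta$ and let $h:S\to\mathbb{R}$ be a continuously differentiable function. If $h$ is strongly geodesic preinvex of order $m$ with respect to $\eta$, then $h$ is strongly $\eta$-invex of order $m$ with respect to $\eta$ on $S$.
   Context: Manifolds are $C^\infty$, modelled on a Hilbert space (finite or infinite dimensional), with Riemannian metric $\langle\cdot,\cdot\rangle_p$ and norm $\|\cdot\|_p$ on $T_pM$. Geodesic invex set: a nonempty set $S\subseteq M$ is geodesic invex with respect to $\eta$ if for all $u,v\in S$ there is exactly one geodesic $r_{u,v}:[0,1]\to M$ such that $r_{u,v}(0)=v$, $r_{u,v}'(0)=\eta(u,v)$ and $r_{u,v}(s)\in S$ for all $s\in[0,1]$. Strongly geodesic preinvex of order $m$ with respect to $\eta$ (for $h:S\to\mathbb{R}$, $S$ geodesic invex): there exists $\delta>0$ such that for all $u,v\in S$ and $s\in[0,1]$, $$h(r_{u,v}(s))\le s\,h(u)+(1-s)h(v)-\delta s(1-s)\|\eta(u,v)\|_v^m .$$ Strongly $\eta$-invex of order $m$ with respect to $\eta$ on $S$ (for differentiable $h:S\to\mathbb{R}$): there exists $\delta>0$ such that for all $u,v\in S$, $$h(u)\ge h(v)+dh_v(\eta(u,v))+\delta\|\eta(u,v)\|_v^m ,$$ where $dh_v$ is the differential of $h$ at $v$. *)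

theory Defs
  imports "HOL-Analysis.Analysis"
begin

section \<open>Smooth maps between normed spaces\<close>

definition bounded_multilinear ::
    "nat \<Rightarrow> ('e::real_normed_vector list \<Rightarrow> 'f::real_normed_vector) \<Rightarrow> bool" where
  "bounded_multilinear n T \<longleftrightarrow>
     (\<forall>vs i. length vs = n \<and> i < n \<longrightarrow> linear (\<lambda>v. T (vs[i := v]))) \<and>
     (\<exists>K. \<forall>vs. length vs = n \<longrightarrow> norm (T vs) \<le> K * prod_list (map norm vs))"

text \<open>
  \<open>D n x\<close> is the \<open>n\<close>-th Frechet derivative of \<open>f\<close> at \<open>x\<close>, as a bounded multilinear map on
  lists of \<open>n\<close> vectors; a single type thus serves for all orders. The last condition says that
  \<open>D (Suc n) x\<close> is the derivative of \<open>D n\<close> at \<open>x\<close> with respect to the operator norm on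
  \<open>n\<close>-linear maps.
\<close>

definition smooth_on ::
    "'e::real_normed_vector set \<Rightarrow> ('e \<Rightarrow> 'f::real_normed_vector) \<Rightarrow> bool" where
  "smooth_on U f \<longleftrightarrow>
     (\<exists>D :: nat \<Rightarrow> 'e \<Rightarrow> 'e list \<Rightarrow> 'f.
        (\<forall>x\<in>U. D 0 x [] = f x) \<and>
        (\<forall>n. \<forall>x\<in>U. bounded_multilinear n (D n x)) \<and>
        (\<forall>n. \<forall>x\<in>U. \<forall>\<epsilon>>0. \<forall>\<^sub>F y in at x within U. \<forall>vs. length vs = n \<longrightarrow>
           norm (D n y vs - D n x vs - D (Suc n) x ((y - x) # vs))
             \<le> \<epsilon> * norm (y - x) * prod_list (map norm vs)))"

section \<open>Manifolds modelled on a Hilbert space\<close>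

type_synonym ('a, 'e) chart = "'a set \<times> ('a \<Rightarrow> 'e)"

abbreviation chart_inv :: "('a, 'e) chart \<Rightarrow> 'e \<Rightarrow> 'a" where
  "chart_inv c \<equiv> inv_into (fst c) (snd c)"

locale hilbert_manifold =
  fixes M :: "'a topology"
    and A :: "('a, 'e::{real_inner, banach}) chart set"
  assumes hausdorff: "Hausdorff_space M"
    and covering: "topspace M = (\<Union>c\<in>A. fst c)"
    and chart_open: "\<And>c. c \<in> A \<Longrightarrow> openin M (fst c) \<and> open (snd c ` fst c)"
    and chart_homeomorphic: "\<And>c. c \<in> A \<Longrightarrow>
      homeomorphic_map (subtopology M (fst c)) (top_of_set (snd c ` fst c)) (snd c)"
    and transition_smooth: "\<And>c d. c \<in> A \<Longrightarrow> d \<in> A \<Longrightarrow>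
      smooth_on (snd c ` (fst c \<inter> fst d)) (snd d \<circ> chart_inv c)"

definition charts_at :: "('a, 'e) chart set \<Rightarrow> 'a \<Rightarrow> ('a, 'e) chart set" where
  "charts_at A p = {c \<in> A. p \<in> fst c}"

text \<open>
  A tangent vector is the family of its components in all charts around its base point, which
  transform by the derivatives of the transition maps. Components in the remaining charts are
  fixed to be \<open>0\<close>, so that equality of tangent vectors at a point is equality of functions.
  The vector space operations are pointwise; the base point is always given separately.
\<close>

type_synonym ('a, 'e) tangent = "('a, 'e) chart \<Rightarrow> 'e"

definition tangent_space ::
    "('a, 'e::real_normed_vector) chart set \<Rightarrow> 'a \<Rightarrow> ('a, 'e) tangent set" where
  "tangent_space A p =
     {\<xi>. (\<forall>c. c \<notin> charts_at A p \<longrightarrow> \<xi> c = 0) \<and>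
         (\<forall>c\<in>charts_at A p. \<forall>d\<in>charts_at A p.
            \<xi> d = frechet_derivative (snd d \<circ> chart_inv c) (at (snd c p)) (\<xi> c))}"

definition tangent_of ::
    "('a, 'e::real_normed_vector) chart set \<Rightarrow> ('a, 'e) chart \<Rightarrow> 'a \<Rightarrow> 'e \<Rightarrow> ('a, 'e) tangent" where
  "tangent_of A c p v =
     (\<lambda>d. if d \<in> charts_at A p
          then frechet_derivative (snd d \<circ> chart_inv c) (at (snd c p)) v else 0)"

section \<open>Riemannian metrics\<close>

type_synonym ('a, 'e) metric_tensor = "'a \<Rightarrow> ('a, 'e) tangent \<Rightarrow> ('a, 'e) tangent \<Rightarrow> real"

definition local_metric ::
    "('a, 'e::real_normed_vector) chart set \<Rightarrow> ('a, 'e) metric_tensor \<Rightarrow>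
     ('a, 'e) chart \<Rightarrow> 'e \<Rightarrow> 'e \<Rightarrow> 'e \<Rightarrow> real" where
  "local_metric A g c x v w =
     g (chart_inv c x) (tangent_of A c (chart_inv c x) v) (tangent_of A c (chart_inv c x) w)"

text \<open>
  The last assumption, automatic in finite dimension, makes each inner product induce the given
  Hilbert space topology on the tangent space (the opposite estimate is part of \<open>metric_smooth\<close>).
\<close>

locale riemannian_manifold = hilbert_manifold M A
  for M :: "'a topology" and A :: "('a, 'e::{real_inner, banach}) chart set" +
  fixes g :: "('a, 'e) metric_tensor"
  assumes metric_sym: "\<And>p \<xi> \<zeta>. p \<in> topspace M \<Longrightarrow>
      \<xi> \<in> tangent_space A p \<Longrightarrow> \<zeta> \<in> tangent_space A p \<Longrightarrow> g p \<xi> \<zeta> = g p \<zeta> \<xi>"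
    and metric_linear: "\<And>p \<xi> \<xi>' \<zeta> a. p \<in> topspace M \<Longrightarrow>
      \<xi> \<in> tangent_space A p \<Longrightarrow> \<xi>' \<in> tangent_space A p \<Longrightarrow> \<zeta> \<in> tangent_space A p \<Longrightarrow>
      g p (\<lambda>c. a *\<^sub>R \<xi> c + \<xi>' c) \<zeta> = a * g p \<xi> \<zeta> + g p \<xi>' \<zeta>"
    and metric_pos: "\<And>p \<xi>. p \<in> topspace M \<Longrightarrow>
      \<xi> \<in> tangent_space A p \<Longrightarrow> \<xi> \<noteq> (\<lambda>_. 0) \<Longrightarrow> g p \<xi> \<xi> > 0"
    and metric_smooth: "\<And>c. c \<in> A \<Longrightarrow>
      \<exists>G :: 'e \<Rightarrow> 'e \<Rightarrow>\<^sub>L 'e \<Rightarrow>\<^sub>L real. smooth_on (snd c ` fst c) G \<and>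
        (\<forall>x\<in>snd c ` fst c. \<forall>v w. blinfun_apply (blinfun_apply (G x) v) w = local_metric A g c x v w)"
    and metric_strong: "\<And>c x. c \<in> A \<Longrightarrow> x \<in> snd c ` fst c \<Longrightarrow>
      \<exists>k>0. \<forall>v. k * (norm v)\<^sup>2 \<le> local_metric A g c x v v"

definition tangent_norm ::
    "('a, 'e) metric_tensor \<Rightarrow> 'a \<Rightarrow> ('a, 'e) tangent \<Rightarrow> real" where
  "tangent_norm g p \<xi> = sqrt (g p \<xi> \<xi>)"

text \<open>
  The Christoffel map of the Levi-Civita connection in the chart \<open>c\<close>: the connection
  \<open>\<nabla>\<^bsub>u\<^esub> V = DV(x) u + \<Gamma> u V\<close> is torsion-free (\<open>\<Gamma>\<close> is symmetric) and metric.
\<close>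

definition christoffel ::
    "('a, 'e::real_normed_vector) chart set \<Rightarrow> ('a, 'e) metric_tensor \<Rightarrow>
     ('a, 'e) chart \<Rightarrow> 'e \<Rightarrow> 'e \<Rightarrow> 'e \<Rightarrow> 'e" where
  "christoffel A g c x =
     (THE \<Gamma>. bounded_bilinear \<Gamma> \<and>
        (\<forall>v w. \<Gamma> v w = \<Gamma> w v) \<and>
        (\<forall>u v w. frechet_derivative (\<lambda>y. local_metric A g c y v w) (at x) u =
           local_metric A g c x (\<Gamma> u v) w + local_metric A g c x v (\<Gamma> u w)))"

section \<open>Geodesics\<close>

definition velocity ::
    "('a, 'e::real_normed_vector) chart set \<Rightarrow> (real \<Rightarrow> 'a) \<Rightarrow> real \<Rightarrow> ('a, 'e) tangent" where
  "velocity A r t =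
     (\<lambda>c. if c \<in> charts_at A (r t)
          then vector_derivative (snd c \<circ> r) (at t within {0..1}) else 0)"

text \<open>The covariant derivative at \<open>t\<close> of the vector field \<open>X\<close> along the curve \<open>r\<close>.\<close>

definition covariant_derivative ::
    "('a, 'e::real_normed_vector) chart set \<Rightarrow> ('a, 'e) metric_tensor \<Rightarrow>
     (real \<Rightarrow> 'a) \<Rightarrow> (real \<Rightarrow> ('a, 'e) tangent) \<Rightarrow> real \<Rightarrow> ('a, 'e) tangent" where
  "covariant_derivative A g r X t =
     (\<lambda>c. if c \<in> charts_at A (r t)
          then vector_derivative (\<lambda>s. X s c) (at t within {0..1}) +
               christoffel A g c (snd c (r t)) (velocity A r t c) (X t c)
          else 0)"

text \<open>
  Two derivatives are required of a geodesic; since the geodesic equation has smooth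
  coefficients, all higher ones then exist.
\<close>

definition geodesic ::
    "'a topology \<Rightarrow> ('a, 'e::real_normed_vector) chart set \<Rightarrow> ('a, 'e) metric_tensor \<Rightarrow>
     (real \<Rightarrow> 'a) \<Rightarrow> bool" where
  "geodesic M A g r \<longleftrightarrow>
     continuous_map (top_of_set {0..1}) M r \<and>
     (\<forall>t\<in>{0..1}. \<forall>c\<in>charts_at A (r t).
        (snd c \<circ> r) differentiable (at t within {0..1}) \<and>
        (\<lambda>s. velocity A r s c) differentiable (at t within {0..1})) \<and>
     (\<forall>t\<in>{0..1}. covariant_derivative A g r (velocity A r) t = (\<lambda>_. 0))"

section \<open>Differentiable functions on an open subset\<close>

definition continuously_differentiable_on ::
    "('a, 'e::real_normed_vector) chart set \<Rightarrow> 'a set \<Rightarrow> ('a \<Rightarrow> real) \<Rightarrow> bool" where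
  "continuously_differentiable_on A S h \<longleftrightarrow>
     (\<forall>c\<in>A. \<exists>D :: 'e \<Rightarrow> 'e \<Rightarrow>\<^sub>L real.
        continuous_on (snd c ` (fst c \<inter> S)) D \<and>
        (\<forall>x\<in>snd c ` (fst c \<inter> S). ((h \<circ> chart_inv c) has_derivative blinfun_apply (D x)) (at x)))"

text \<open>By the chain rule, the value does not depend on the chart chosen.\<close>

definition differential ::
    "('a, 'e::real_normed_vector) chart set \<Rightarrow> ('a \<Rightarrow> real) \<Rightarrow> 'a \<Rightarrow> ('a, 'e) tangent \<Rightarrow> real" where
  "differential A h p \<xi> =
     (let c = SOME c. c \<in> charts_at A p
      in frechet_derivative (h \<circ> chart_inv c) (at (snd c p)) (\<xi> c))"

section \<open>Invexity\<close>

text \<open>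
  Curves defined on \<open>[0,1]\<close> only are total functions that are \<open>undefined\<close> elsewhere, so that the
  uniqueness of the geodesic is meaningful.
\<close>

definition invex_geodesic ::
    "'a topology \<Rightarrow> ('a, 'e::real_normed_vector) chart set \<Rightarrow> ('a, 'e) metric_tensor \<Rightarrow>
     ('a \<Rightarrow> 'a \<Rightarrow> ('a, 'e) tangent) \<Rightarrow> 'a set \<Rightarrow> 'a \<Rightarrow> 'a \<Rightarrow> (real \<Rightarrow> 'a) \<Rightarrow> bool" where
  "invex_geodesic M A g \<eta> S u v r \<longleftrightarrow>
     r \<in> extensional {0..1} \<and> geodesic M A g r \<and>
     r 0 = v \<and> velocity A r 0 = \<eta> u v \<and> (\<forall>s\<in>{0..1}. r s \<in> S)"

definition geodesic_invex ::
    "'a topology \<Rightarrow> ('a, 'e::real_normed_vector) chart set \<Rightarrow> ('a, 'e) metric_tensor \<Rightarrow>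
     ('a \<Rightarrow> 'a \<Rightarrow> ('a, 'e) tangent) \<Rightarrow> 'a set \<Rightarrow> bool" where
  "geodesic_invex M A g \<eta> S \<longleftrightarrow>
     S \<noteq> {} \<and> S \<subseteq> topspace M \<and> (\<forall>u\<in>S. \<forall>v\<in>S. \<exists>!r. invex_geodesic M A g \<eta> S u v r)"

definition the_geodesic ::
    "'a topology \<Rightarrow> ('a, 'e::real_normed_vector) chart set \<Rightarrow> ('a, 'e) metric_tensor \<Rightarrow>
     ('a \<Rightarrow> 'a \<Rightarrow> ('a, 'e) tangent) \<Rightarrow> 'a set \<Rightarrow> 'a \<Rightarrow> 'a \<Rightarrow> real \<Rightarrow> 'a" where
  "the_geodesic M A g \<eta> S u v = (THE r. invex_geodesic M A g \<eta> S u v r)"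

definition strongly_geodesic_preinvex ::
    "'a topology \<Rightarrow> ('a, 'e::real_normed_vector) chart set \<Rightarrow> ('a, 'e) metric_tensor \<Rightarrow>
     ('a \<Rightarrow> 'a \<Rightarrow> ('a, 'e) tangent) \<Rightarrow> nat \<Rightarrow> 'a set \<Rightarrow> ('a \<Rightarrow> real) \<Rightarrow> bool" where
  "strongly_geodesic_preinvex M A g \<eta> m S h \<longleftrightarrow>
     (\<exists>\<delta>>0. \<forall>u\<in>S. \<forall>v\<in>S. \<forall>s\<in>{0..1}.
        h (the_geodesic M A g \<eta> S u v s)
          \<le> s * h u + (1 - s) * h v - \<delta> * s * (1 - s) * tangent_norm g v (\<eta> u v) ^ m)"

definition strongly_invex ::
    "('a, 'e::real_normed_vector) chart set \<Rightarrow> ('a, 'e) metric_tensor \<Rightarrow>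
     ('a \<Rightarrow> 'a \<Rightarrow> ('a, 'e) tangent) \<Rightarrow> nat \<Rightarrow> 'a set \<Rightarrow> ('a \<Rightarrow> real) \<Rightarrow> bool" where
  "strongly_invex A g \<eta> m S h \<longleftrightarrow>
     (\<exists>\<delta>>0. \<forall>u\<in>S. \<forall>v\<in>S.
        h u \<ge> h v + differential A h v (\<eta> u v) + \<delta> * tangent_norm g v (\<eta> u v) ^ m)"

end

theory Submission
  imports Defs
begin

text \<open>
  Preinvexity bounds the difference quotients of \<open>h\<close> along the geodesic \<open>r\<^bsub>u,v\<^esub>\<close> at its
  starting point: \<open>(h (r s) - h v) / s \<le> h u - h v - \<delta> (1 - s) \<parallel>\<eta> u v\<parallel>\<^sup>m\<close>. As \<open>s \<rightarrow> 0\<close>, the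
  left-hand side tends to \<open>dh\<^bsub>v\<^esub> (\<eta> u v)\<close> by the chain rule, so the same \<open>\<delta>\<close> works for invexity.
\<close>

lemma the_geodesic_invex_geodesic:
  assumes "geodesic_invex M A g \<eta> S" "u \<in> S" "v \<in> S"
  shows "invex_geodesic M A g \<eta> S u v (the_geodesic M A g \<eta> S u v)"
proof -
  have "\<exists>!r. invex_geodesic M A g \<eta> S u v r"
    using assms by (auto simp: geodesic_invex_def)
  then show ?thesis
    unfolding the_geodesic_def by (rule theI')
qed

text \<open>Meant for \<open>W\<close> a chart domain: near \<open>t\<close> the curve stays inside
  one chart, so it can be studied in coordinates there.\<close>

lemma continuous_map_eventually_within:
  assumes r: "continuous_map (top_of_set T) M r" and W: "openin M W"
    and t: "t \<in> T" "r t \<in> W"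
  shows "\<forall>\<^sub>F s in at t within T. r s \<in> W"
proof -
  have "openin (top_of_set T) {s \<in> topspace (top_of_set T). r s \<in> W}"
    using r W by (rule openin_continuous_map_preimage)
  then obtain V where V: "open V" "{s \<in> T. r s \<in> W} = T \<inter> V"
    by (auto simp: openin_open)
  then have "t \<in> V" using t by blast
  then have "\<forall>\<^sub>F s in at t within T. s \<in> V"
    using V(1) eventually_at_topological by blast
  moreover have "\<forall>\<^sub>F s in at t within T. s \<in> T"
    by (simp add: eventually_at_topological) blast
  ultimately show ?thesis
    by eventually_elim (use V(2) in blast)
qed

text \<open>Injectivity, part of being a homeomorphism onto the image, makes
  \<open>chart_inv c\<close> a genuine left inverse of \<open>snd c\<close> on
  \<open>fst c\<close>.\<close>

lemma (in hilbert_manifold) chart_inj_on: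
  assumes "c \<in> A"
  shows "inj_on (snd c) (fst c)"
proof -
  have "topspace (subtopology M (fst c)) = fst c"
    using chart_open[OF assms] openin_subset by fastforce
  then show ?thesis
    using homeomorphic_imp_injective_map[OF chart_homeomorphic[OF assms]] by simp
qed

text \<open>Chain rule in a chart \<open>c\<close> around \<open>r t\<close>: near \<open>t\<close>,
  \<open>h \<circ> r\<close> is \<open>h \<circ> chart_inv c\<close> composed with the coordinate
  curve \<open>snd c \<circ> r\<close>. At the ends of \<open>{0..1}\<close> the derivative is
  one-sided.\<close>

lemma (in hilbert_manifold) has_vector_derivative_along_curve:
  assumes r: "continuous_map (top_of_set {0..1}) M r" and t: "t \<in> {0..1}"
    and diff: "\<And>c. c \<in> charts_at A (r t) \<Longrightarrow> (snd c \<circ> r) differentiable (at t within {0..1})"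
    and h: "continuously_differentiable_on A S h" and rt: "r t \<in> S" "r t \<in> topspace M"
  shows "((h \<circ> r) has_vector_derivative differential A h (r t) (velocity A r t))
           (at t within {0..1})"
proof -
  \<comment> \<open>This is the very chart that \<open>differential\<close> selects, so its value
    appears below without a change of coordinates.\<close>
  define c where "c = (SOME c. c \<in> charts_at A (r t))"
  have "\<exists>c. c \<in> charts_at A (r t)"
    using covering rt(2) by (auto simp: charts_at_def)
  then have c: "c \<in> charts_at A (r t)"
    unfolding c_def by (rule someI_ex)
  then have cA: "c \<in> A" and p: "r t \<in> fst c"
    by (auto simp: charts_at_def)
  have inv: "chart_inv c (snd c q) = q" if "q \<in> fst c" for q
    using chart_inj_on[OF cA] that by simp
  let ?f = "h \<circ> chart_inv c" and ?x = "snd c (r t)"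
  have "?f differentiable (at ?x)"
    using h cA p rt(1) unfolding continuously_differentiable_on_def differentiable_def by blast
  then have f: "(?f has_derivative frechet_derivative ?f (at ?x)) (at ((snd c \<circ> r) t))"
    by (simp add: frechet_derivative_works)
  have "((snd c \<circ> r) has_vector_derivative velocity A r t c) (at t within {0..1})"
    using diff[OF c] c by (simp add: velocity_def vector_derivative_works)
  then have "((snd c \<circ> r) has_derivative (\<lambda>s. s *\<^sub>R velocity A r t c)) (at t within {0..1})"
    by (simp add: has_vector_derivative_def)
  then have "(?f \<circ> (snd c \<circ> r) has_derivative
      frechet_derivative ?f (at ?x) \<circ> (\<lambda>s. s *\<^sub>R velocity A r t c)) (at t within {0..1})"
    using has_derivative_at_withinI[OF f] by (rule diff_chain_within)
  then have "(?f \<circ> (snd c \<circ> r) has_vector_derivative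
      frechet_derivative ?f (at ?x) (velocity A r t c)) (at t within {0..1})"
    using linear_scale[OF has_derivative_linear[OF f]]
    by (simp add: has_vector_derivative_def o_def)
  moreover have "differential A h (r t) (velocity A r t) =
      frechet_derivative ?f (at ?x) (velocity A r t c)"
    by (simp add: differential_def Let_def c_def)
  \<comment> \<open>The factorisation through \<open>c\<close> is guaranteed only while
    \<open>r s\<close> lies in the open set \<open>fst c\<close>, hence an eventual
    equality.\<close>
  moreover have "\<forall>\<^sub>F s in at t within {0..1}. (?f \<circ> (snd c \<circ> r)) s = (h \<circ> r) s"
    using continuous_map_eventually_within[OF r _ t p] chart_open[OF cA]
    by (auto elim!: eventually_mono simp: inv)
  ultimately show ?thesis
    using has_derivative_transform_eventually[of "?f \<circ> (snd c \<circ> r)" _ t "{0..1}" "h \<circ> r"]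
      t p inv
    by (simp add: has_vector_derivative_def)
qed

text \<open>For \<open>s > 0\<close> the difference quotient of \<open>f\<close> at \<open>0\<close>
  is at most \<open>b s\<close>; let \<open>s\<close> tend to \<open>0\<close>.\<close>

lemma right_derivative_le:
  fixes f b :: "real \<Rightarrow> real"
  assumes f: "(f has_vector_derivative D) (at 0 within {0..1})"
    and b: "continuous (at 0 within {0..1}) b"
    and le: "\<And>s. s \<in> {0..1} \<Longrightarrow> f s \<le> f 0 + s * b s"
  shows "D \<le> b 0"
proof (rule tendsto_le)
  show "(b \<longlongrightarrow> b 0) (at 0 within {0..1})"
    using b by (simp add: continuous_within)
  show "((\<lambda>s. (f s - f 0) / (s - 0)) \<longlongrightarrow> D) (at 0 within {0..1})"
    using f by (simp add: has_field_derivative_iff flip: has_real_derivative_iff_has_vector_derivative)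
  have "(f s - f 0) / (s - 0) \<le> b s" if "s \<in> {0..1}" "s \<noteq> 0" for s
    using le[OF that(1)] that by (simp add: divide_le_eq algebra_simps)
  then show "\<forall>\<^sub>F s in at 0 within {0..1}. (f s - f 0) / (s - 0) \<le> b s"
    by (auto simp: eventually_at_topological)
  \<comment> \<open>Comparing limits requires a nontrivial filter: \<open>0\<close> is a limit point
    of \<open>{0..1}\<close>.\<close>
  show "at (0::real) within {0..1} \<noteq> bot"
    by (simp add: trivial_limit_within islimpt_Icc)
qed

theorem theorem3:
  fixes M :: "'a topology"
    and A :: "('a, 'e::{real_inner, banach}) chart set"
    and g :: "('a, 'e) metric_tensor"
    and \<eta> :: "'a \<Rightarrow> 'a \<Rightarrow> ('a, 'e) tangent"
    and m :: nat
    and S :: "'a set"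
    and h :: "'a \<Rightarrow> real"
  assumes "riemannian_manifold M A g"
    and "\<And>u v. u \<in> topspace M \<Longrightarrow> v \<in> topspace M \<Longrightarrow> \<eta> u v \<in> tangent_space A v"
    and "m > 0"
    and "openin M S"
    and "geodesic_invex M A g \<eta> S"
    and "continuously_differentiable_on A S h"
    and "strongly_geodesic_preinvex M A g \<eta> m S h"
  shows "strongly_invex A g \<eta> m S h"
proof -
  interpret riemannian_manifold M A g by fact
  obtain \<delta> where "\<delta> > 0" and preinvex: "\<And>u v s. u \<in> S \<Longrightarrow> v \<in> S \<Longrightarrow> s \<in> {0..1} \<Longrightarrow>
      h (the_geodesic M A g \<eta> S u v s)
        \<le> s * h u + (1 - s) * h v - \<delta> * s * (1 - s) * tangent_norm g v (\<eta> u v) ^ m"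
    using assms(7) unfolding strongly_geodesic_preinvex_def by blast
  have "h v + differential A h v (\<eta> u v) + \<delta> * tangent_norm g v (\<eta> u v) ^ m \<le> h u"
    if uv: "u \<in> S" "v \<in> S" for u v
  proof -
    define r where "r = the_geodesic M A g \<eta> S u v"
    define N where "N = tangent_norm g v (\<eta> u v) ^ m"
    have r: "geodesic M A g r" "r 0 = v" "velocity A r 0 = \<eta> u v"
      using the_geodesic_invex_geodesic[OF assms(5) uv]
      by (simp_all add: r_def invex_geodesic_def)
    have "((h \<circ> r) has_vector_derivative differential A h (r 0) (velocity A r 0))
        (at 0 within {0..1})"
      using r(1,2) uv(2) openin_subset[OF assms(4)] assms(6)
      by (intro has_vector_derivative_along_curve) (auto simp: geodesic_def)
    \<comment> \<open>This \<open>b\<close> comes from writing the preinvexity bound as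
      \<open>h v + s * b s\<close>; its value at \<open>0\<close> is
      \<open>h u - h v - \<delta> * N\<close>, the bound that invexity asks for.\<close>
    moreover have "continuous (at 0 within {0..1}) (\<lambda>s. h u - h v - \<delta> * (1 - s) * N)"
      by (intro continuous_intros)
    moreover have "(h \<circ> r) s \<le> (h \<circ> r) 0 + s * (h u - h v - \<delta> * (1 - s) * N)"
      if "s \<in> {0..1}" for s
      using preinvex[OF uv that] r(2) by (simp add: r_def N_def algebra_simps)
    ultimately have "differential A h (r 0) (velocity A r 0) \<le> h u - h v - \<delta> * (1 - 0) * N"
      by (rule right_derivative_le)
    then show ?thesis
      using r by (simp add: N_def)
  qed
  then show ?thesis
    unfolding strongly_invex_def using \<open>\<delta> > 0\<close> by blast
qed

end
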